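(* Let $\{a_{n,k}\}_{n\ge 1,\,k\ge 1}$ be the array of real numbers satisfying $a_{n,1}=2^{2(n-1)}$ and $a_{n,n}=1$ for all $n\ge 1$, $a_{n,k}=0$ for all $k>n$, and $$a_{n,k}=\frac{1}{n-1}\left[(k-1)\,a_{n-1,k-1}+2(2n-1-k)\,a_{n-1,k}\right]\qquad\text{for all } n>1 \text{ and } k=1,\dots,n-1,$$ where for $k=1$ the first term in the bracket is $0$. Then $a_{n,n}=1$ for all $n\geq 1$, and for all $n>1$ and $k=1,\dots,n-1$, $$a_{n,k}=2^{2(n-k)}\left[1+(k-1)\sum_{j=0}^{n-k-1}\frac{2^{-2(j+1)}\,(k+2j)!}{(j+1)!\,(k+j)!}\right].$$
   Context: The indices $n,k$ are positive integers. The recurrence and the listed boundary values determine the array $\{a_{n,k}\}$ uniquely. *)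

theory Defs imports Complex_Main begin

end

theory Submission imports Defs begin

text \<open>
  Put \<open>m = n - k\<close> and divide \<open>a n k\<close> by \<open>4 ^ m\<close>.  The claimed value becomes
  \<open>f k m = 1 + (k - 1) * (\<Sum>j<m. (1/4)^(j+1) * (k+2j)! / ((j+1)! (k+j)!))\<close>, a
  partial sum of a power of the Catalan series \<open>C x = (\<Sum>i. Catalan i * x ^ i)\<close>: writing
  \<open>i = j + 1\<close>, the number \<open>(k-1) * (k+2i-2)! / (i! (k+i-1)!)\<close> is the coefficient of
  \<open>x ^ i\<close> in \<open>(C x) ^ (k-1)\<close>, and \<open>f k m\<close> adds the terms of degree at most \<open>m\<close> at
  \<open>x = 1/4\<close>.

  The recurrence for \<open>a\<close> relates the columns \<open>k\<close> and \<open>k + 1\<close>.  On the level of power series,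
  \<open>C = 1 + x * C\<^sup>2\<close> links consecutive powers of \<open>C\<close>; its counterpart for partial sums is
  \<open>f k (m+1) = f (k+1) m / 2 + (1/4)^(m+1) * binom (2m+k+1) (m+1)\<close>
  (lemma \<open>catalan_power_sum_shift_column\<close>), which follows by induction on \<open>m\<close> because the
  increments of both sides agree.  The last increment of \<open>f (k+1)\<close> is a rational multiple of the
  same binomial term, so that term can be eliminated.  What remains
  (lemma \<open>catalan_power_sum_recurrence\<close>) is the recurrence of the theorem after division by
  \<open>4 ^ m\<close>, and induction on \<open>n\<close> finishes the proof; the first column and the
  diagonal are the boundary values.
\<close>

definition catalan_power_sum :: "nat \<Rightarrow> nat \<Rightarrow> real" where
  "catalan_power_sum k m =
    1 + (real k - 1) * (\<Sum>j<m. (1/4) ^ (j + 1) * fact (k + 2 * j) / (fact (j + 1) * fact (k + j)))"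

lemma catalan_power_sum_0 [simp]: "catalan_power_sum k 0 = 1"
  by (simp add: catalan_power_sum_def)

lemma catalan_power_sum_1 [simp]: "catalan_power_sum (Suc 0) m = 1"
  by (simp add: catalan_power_sum_def)

lemma catalan_power_sum_Suc:
  "catalan_power_sum k (Suc m) = catalan_power_sum k m +
    (real k - 1) * ((1/4) ^ (m + 1) * fact (k + 2 * m) / (fact (m + 1) * fact (k + m)))"
  by (simp add: catalan_power_sum_def distrib_left)

text \<open>
  By induction it suffices to compare the increments from \<open>m\<close> to \<open>m + 1\<close>.  All four terms of that
  comparison are polynomial multiples of
  \<open>T = (1/4)^(m+1) * (2m+k+1)! / ((m+2)! (m+k+1)!)\<close>, which reduces it to the identity
  \<open>(k-1)(2m+k+2) + 4(m+2)(m+k+1) = 2k(m+2) + (2m+k+2)(2m+k+3)\<close>.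
\<close>

lemma catalan_power_sum_shift_column:
  "catalan_power_sum k (Suc m) = catalan_power_sum (Suc k) m / 2 +
    (1/4) ^ (m + 1) * fact (2 * m + k + 1) / (fact (m + 1) * fact (m + k))"
proof (induction m)
  case 0
  show ?case by (simp add: catalan_power_sum_Suc field_simps)
next
  case (Suc m)
  define T :: real where "T = (1/4) ^ (m + 1) * fact (2 * m + k + 1) / (fact (m + 2) * fact (m + k + 1))"
  define u where "u = real m + 2"
  define v where "v = real m + real k + 1"
  define w where "w = 2 * real m + real k + 2"
  have pos: "u > 0" "v > 0"
    by (simp_all add: u_def v_def)
  have facts: "fact (m + 2) = u * fact (m + 1)" "fact (m + k + 1) = v * fact (m + k)"
      "fact (2 * m + k + 2) = w * fact (2 * m + k + 1)"
      "fact (2 * m + k + 3) = (w + 1) * w * fact (2 * m + k + 1)"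
    by (simp_all add: u_def v_def w_def numeral_3_eq_3 algebra_simps)
  have idx: "Suc m + 1 = m + 2" "k + Suc m = m + k + 1" "Suc k + m = m + k + 1" "Suc m + k = m + k + 1"
      "k + 2 * Suc m = 2 * m + k + 2" "Suc k + 2 * m = 2 * m + k + 1" "2 * Suc m + k + 1 = 2 * m + k + 3"
    by simp_all
  have quarter: "(1/4::real) ^ (m + 2) = (1/4) ^ (m + 1) / 4"
    by simp
  have incr_left: "(1/4) ^ (Suc m + 1) * fact (k + 2 * Suc m) / (fact (Suc m + 1) * fact (k + Suc m))
      = w / 4 * T"
    unfolding T_def idx facts quarter by (simp del: fact_Suc)
  have incr_right: "(1/4) ^ (m + 1) * fact (Suc k + 2 * m) / (fact (m + 1) * fact (Suc k + m)) = u * T"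
    unfolding T_def idx facts using pos by (simp del: fact_Suc)
  have binom_new: "(1/4) ^ (Suc m + 1) * fact (2 * Suc m + k + 1) / (fact (Suc m + 1) * fact (Suc m + k))
      = (w + 1) * w / 4 * T"
    unfolding T_def idx facts quarter by (simp del: fact_Suc)
  have binom_old: "(1/4) ^ (m + 1) * fact (2 * m + k + 1) / (fact (m + 1) * fact (m + k)) = u * v * T"
    unfolding T_def idx facts using pos by (simp del: fact_Suc)
  show ?case
    unfolding catalan_power_sum_Suc[of k "Suc m"] catalan_power_sum_Suc[of "Suc k" m] Suc.IH
      incr_left incr_right binom_new binom_old
    by (simp add: u_def v_def w_def field_simps)
qed

text \<open>
  This is the recurrence of the array in column \<open>k + 1\<close> at distance \<open>m + 1\<close> below the diagonal,
  divided by \<open>4 ^ (m + 1)\<close>.  The binomial term in the column shift equals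
  \<open>m + k + 1\<close> times the last summand of \<open>catalan_power_sum (k + 1) (m + 1)\<close> without its
  factor \<open>k\<close>, so it can be eliminated.
\<close>

lemma catalan_power_sum_recurrence:
  "(real m + real k + 1) * catalan_power_sum (Suc k) (Suc m) =
    real k * catalan_power_sum k (Suc m)
      + (real m + 1 + real k / 2) * catalan_power_sum (Suc k) m"
proof -
  define t :: real where
    "t = (1/4) ^ (m + 1) * fact (Suc k + 2 * m) / (fact (m + 1) * fact (Suc k + m))"
  define v where "v = real m + real k + 1"
  have "v > 0"
    by (simp add: v_def)
  moreover have "fact (Suc k + m) = v * fact (m + k)"
    by (simp add: v_def algebra_simps)
  moreover have "Suc k + 2 * m = 2 * m + k + 1"
    by simp
  ultimately have "(1/4) ^ (m + 1) * fact (2 * m + k + 1) / (fact (m + 1) * fact (m + k)) = v * t"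
    unfolding t_def by (simp del: fact_Suc add: add.commute)
  then have "catalan_power_sum k (Suc m) =
      catalan_power_sum (Suc k) m / 2 + v * t"
    using catalan_power_sum_shift_column[of k m] by simp
  moreover have "catalan_power_sum (Suc k) (Suc m) = catalan_power_sum (Suc k) m + real k * t"
    unfolding catalan_power_sum_Suc t_def by simp
  ultimately show ?thesis by (simp add: v_def field_simps)
qed

theorem theorem1:
  fixes a :: "nat \<Rightarrow> nat \<Rightarrow> real"
  assumes first_col: "\<And>n. n \<ge> 1 \<Longrightarrow> a n 1 = 2 ^ (2 * (n - 1))"
    and diag: "\<And>n. n \<ge> 1 \<Longrightarrow> a n n = 1"
    and above: "\<And>n k. n \<ge> 1 \<Longrightarrow> k > n \<Longrightarrow> a n k = 0"
    and rec: "\<And>n k. n > 1 \<Longrightarrow> k \<in> {1..n - 1} \<Longrightarrow>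
      a n k = 1 / (real n - 1) *
        ((if k = 1 then 0 else (real k - 1) * a (n - 1) (k - 1))
          + 2 * (2 * real n - 1 - real k) * a (n - 1) k)"
  shows "(\<forall>n\<ge>1. a n n = 1) \<and>
    (\<forall>n>1. \<forall>k\<in>{1..n - 1}.
      a n k = 2 ^ (2 * (n - k)) *
        (1 + (real k - 1) *
          (\<Sum>j = 0..n - k - 1.
            2 powi (- 2 * (int j + 1)) * fact (k + 2 * j) / (fact (j + 1) * fact (k + j)))))"
proof -
  \<comment> \<open>Including the diagonal \<open>k = n\<close> lets the induction hypothesis cover the entry
    \<open>a (n - 1) (n - 1)\<close> that the recurrence uses for \<open>k = n - 1\<close>.\<close>
  have closed: "a n k = 4 ^ (n - k) * catalan_power_sum k (n - k)" if "1 \<le> k" "k \<le> n" for n k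
    using that
  proof (induction n arbitrary: k)
    case 0
    then show ?case by simp
  next
    case (Suc n)
    consider "k = Suc n" | "k = 1" "k \<le> n" | "1 < k" "k \<le> n"
      using Suc.prems by linarith
    then show ?case
    proof cases
      case 1
      then show ?thesis using diag[of "Suc n"] by simp
    next
      case 2
      then show ?thesis using first_col[of "Suc n"] by (simp add: power_mult)
    next
      case 3
      obtain r where r: "k = Suc r" "1 \<le> r"
        using 3 by (cases k) auto
      obtain m where m: "n = m + k"
        using 3 le_Suc_ex by (metis add.commute)
      have left: "a n r = 4 ^ Suc m * catalan_power_sum r (Suc m)"
        using Suc.IH[of r] r m by simp
      have same: "a n k = 4 ^ m * catalan_power_sum k m"
        using Suc.IH[of k] r m by simp
      have "real n * a (Suc n) k = real r * a n r + 2 * (2 * real m + real r + 2) * a n k"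
        using rec[of "Suc n" k] r m by (simp add: field_simps)
      also have "\<dots> = 4 ^ Suc m *
          (real r * catalan_power_sum r (Suc m) + (real m + 1 + real r / 2) * catalan_power_sum k m)"
        unfolding left same by (simp add: field_simps)
      also have "\<dots> = 4 ^ Suc m * (real n * catalan_power_sum k (Suc m))"
        using catalan_power_sum_recurrence[of m r] r m by (simp add: algebra_simps)
      finally have "real n * a (Suc n) k = real n * (4 ^ Suc m * catalan_power_sum k (Suc m))"
        by (simp only: mult.left_commute)
      moreover have "real n \<noteq> 0" "Suc n - k = Suc m"
        using r m by simp_all
      ultimately show ?thesis by simp
    qed
  qed
  have "a n k = 2 ^ (2 * (n - k)) *
        (1 + (real k - 1) *
          (\<Sum>j = 0..n - k - 1.
            2 powi (- 2 * (int j + 1)) * fact (k + 2 * j) / (fact (j + 1) * fact (k + j))))"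
    if "n > 1" "k \<in> {1..n - 1}" for n k
  proof -
    have range: "{0..n - k - 1} = {..<n - k}"
      using that by auto
    have quarter: "2 powi (- 2 * (int j + 1)) = (1/4 :: real) ^ (j + 1)" for j
    proof -
      have "- 2 * (int j + 1) = - int (2 * (j + 1))"
        by simp
      then have "2 powi (- 2 * (int j + 1)) = inverse ((2::real) ^ (2 * (j + 1)))"
        by (simp only: power_int_minus power_int_of_nat)
      then show ?thesis
        by (simp only: power_mult) (simp add: field_simps)
    qed
    have "a n k = 4 ^ (n - k) * catalan_power_sum k (n - k)"
      using that by (intro closed) auto
    then show ?thesis
      unfolding range catalan_power_sum_def quarter by (simp add: power_mult)
  qed
  then show ?thesis using diag by blast
qed

end
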